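(* Let $p=(12,R)$ be the mesh pattern with $R=\{(0,0),(0,1),(1,1),(1,2),(2,0),(2,1)\}$. Let $F(x)=\sum_{n\ge0}n!\,x^n$, $F(x,q)=\sum_{n\ge 0}x^n\sum_{\pi\in S_n}q^{p(\pi)}$, and $A(x)=\sum_{n\ge0}|S_n(p)|x^n$. Then, as formal power series in $x$, $$A(x)= \frac{F(x)}{1+x(F(x)-1)},\qquad F(x,q)= \frac{F(x)}{1+(1-q)x(F(x)-1)}.$$
   Context: $S_n$ is the set of permutations $\pi=\pi_1\cdots\pi_n$ of $\{1,\dots,n\}$ ($S_0$ contains only the empty permutation). A mesh pattern $(12,R)$ consists of the permutation $12$ and a set $R\subseteq\{0,1,2\}\times\{0,1,2\}$ of shaded boxes. An occurrence of $(12,R)$ in $\pi\in S_n$ is a pair of positions $s<t$ with $\pi_s<\pi_t$ such that, putting $s_0=0,\ s_1=s,\ s_2=t,\ s_3=n+1$ and $v_0=0,\ v_1=\pi_s,\ v_2=\pi_t,\ v_3=n+1$, for every $(i,j)\in R$ there is no position $m$ with $s_i<m<s_{i+1}$ and $v_j<\pi_m<v_{j+1}$. $p(\pi)$ is the number of occurrences of $p$ in $\pi$, and $S_n(p)$ is the set of $\pi\in S_n$ with $p(\pi)=0$ (permutations avoiding $p$). *)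

theory Defs
  imports
    "HOL-Combinatorics.Permutations"
    "HOL-Computational_Algebra.Formal_Power_Series"
    "HOL-Computational_Algebra.Fraction_Field"
    "HOL-Computational_Algebra.Polynomial"
begin

text \<open>A permutation \<open>\<pi>\<^sub>1 \<dots> \<pi>\<^sub>n\<close> in one-line notation is the function \<open>i \<mapsto> \<pi>\<^sub>i\<close> on
  \<open>{1..n}\<close>, extended by the identity; for \<open>n = 0\<close> this leaves exactly one function.\<close>

definition perms :: "nat \<Rightarrow> (nat \<Rightarrow> nat) set" where
  "perms n = {\<pi>. \<pi> permutes {1..n}}"

text \<open>For an occurrence with positions \<open>s, t\<close>, the vertical lines of the mesh are
  \<open>grid_line n s t\<close> and the horizontal ones \<open>grid_line n (\<pi> s) (\<pi> t)\<close>; the argument \<open>k\<close>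
  is meant to be at most 3.\<close>

definition grid_line :: "nat \<Rightarrow> nat \<Rightarrow> nat \<Rightarrow> nat \<Rightarrow> nat" where
  "grid_line n a b k = [0, a, b, n + 1] ! k"

definition mesh12_occurrences ::
    "(nat \<times> nat) set \<Rightarrow> nat \<Rightarrow> (nat \<Rightarrow> nat) \<Rightarrow> (nat \<times> nat) set" where
  "mesh12_occurrences R n \<pi> =
     {(s, t). 1 \<le> s \<and> s < t \<and> t \<le> n \<and> \<pi> s < \<pi> t \<and>
        (\<forall>(i, j) \<in> R. \<not> (\<exists>m.
            grid_line n s t i < m \<and> m < grid_line n s t (i + 1) \<and>
            grid_line n (\<pi> s) (\<pi> t) j < \<pi> m \<and> \<pi> m < grid_line n (\<pi> s) (\<pi> t) (j + 1)))}"

definition mesh12_count :: "(nat \<times> nat) set \<Rightarrow> nat \<Rightarrow> (nat \<Rightarrow> nat) \<Rightarrow> nat" where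
  "mesh12_count R n \<pi> = card (mesh12_occurrences R n \<pi>)"

definition mesh12_avoiders :: "(nat \<times> nat) set \<Rightarrow> nat \<Rightarrow> (nat \<Rightarrow> nat) set" where
  "mesh12_avoiders R n = {\<pi> \<in> perms n. mesh12_count R n \<pi> = 0}"

definition fact_gf :: "'a::semiring_char_0 fps" where
  "fact_gf = Abs_fps (\<lambda>n. fact n)"

definition avoid_gf :: "(nat \<times> nat) set \<Rightarrow> 'a::semiring_1 fps" where
  "avoid_gf R = Abs_fps (\<lambda>n. of_nat (card (mesh12_avoiders R n)))"

definition distr_gf :: "(nat \<times> nat) set \<Rightarrow> 'a::comm_semiring_1 \<Rightarrow> 'a fps" where
  "distr_gf R q = Abs_fps (\<lambda>n. \<Sum>\<pi>\<in>perms n. q ^ mesh12_count R n \<pi>)"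

text \<open>The indeterminate \<open>q\<close>, as an element of the field of rational functions over the
  rationals. Power series in \<open>x\<close> with coefficients polynomial in \<open>q\<close> are regarded as series
  over this field, so that the quotient of power series is the library's division.\<close>

definition q_var :: "rat poly fract" where
  "q_var = Fract [:0, 1:] 1"

end

theory Submission
  imports Defs
begin

unbundle fps_syntax

text \<open>
  Reading off the shaded boxes, positions \<open>s < t\<close> with \<open>\<pi> s = a < \<pi> t\<close> form an occurrence iff all
  entries between them are smaller than \<open>a\<close> and all entries outside exceed \<open>\<pi> t\<close>.  So the values
  up to \<open>\<pi> t\<close> fill the positions from \<open>s\<close> to \<open>t\<close>, which forces \<open>\<pi> t = a + 1\<close> and
  \<open>t = s + a\<close>: the occurrence is a block of consecutive entries \<open>a, \<sigma>, a + 1\<close>, where \<open>\<sigma>\<close> is a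
  permutation of \<open>{1..a - 1}\<close> (\<open>mem_occurrences_iff_block_at\<close>).  In particular an occurrence is determined
  by its head \<open>a\<close>, the occurrences are nested, and those with a head below \<open>a\<close> are exactly the
  occurrences in \<open>\<sigma>\<close> (\<open>block_heads_below\<close>).

  Write \<open>D\<^sub>n\<close> for the sum of \<open>q\<close> to the number of occurrences, over all permutations of \<open>{1..n}\<close>.  The
  identity \<open>q\<^sup>c = 1 + (q - 1) (1 + q + \<dots> + q\<^bsup>c - 1\<^esup>)\<close> becomes, for a permutation with \<open>c\<close>
  occurrences, a sum over its heads \<open>a\<close>, in which the exponent counts the heads below \<open>a\<close>, hence the
  occurrences in \<open>\<sigma>\<close> (\<open>power_card_eq_sum_rank\<close>).  A permutation with head \<open>a\<close> amounts to an arbitrary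
  \<open>\<sigma>\<close> together with the permutation of \<open>n - a\<close> letters got by contracting the block to a
  single letter, so exchanging the sums gives
  \<open>D\<^sub>n = n! + (q - 1) \<Sum>\<^sub>a (n - a)! D\<^bsub>a - 1\<^esub>\<close> with \<open>1 \<le> a < n\<close> (\<open>block_enum_rec\<close>).  For the generating
  function \<open>D\<close> this says \<open>D = F + (q - 1) x (F - 1) D\<close>, which is the second formula; at \<open>q = 0\<close> only the
  avoiders are counted, which gives the first.
\<close>

section \<open>Occurrences are blocks\<close>

definition block_mesh :: "(nat \<times> nat) set" where
  "block_mesh = {(0,0), (0,1), (1,1), (1,2), (2,0), (2,1)}"

text \<open>The block \<open>a, \<sigma>, a + 1\<close> starts at position \<open>s\<close>.  That the entries outside the block exceed \<open>a + 1\<close>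
  follows by injectivity, as the block exhausts the values \<open>{1..a + 1}\<close>.\<close>

definition block_at :: "nat \<Rightarrow> (nat \<Rightarrow> nat) \<Rightarrow> nat \<Rightarrow> nat \<Rightarrow> bool" where
  "block_at n \<pi> s a \<longleftrightarrow> 1 \<le> a \<and> 1 \<le> s \<and> s + a \<le> n \<and> \<pi> s = a \<and> \<pi> (s + a) = a + 1 \<and>
     \<pi> ` {s<..<s + a} = {1..a - 1}"

lemma permutes_eq_iff: "\<pi> permutes A \<Longrightarrow> \<pi> x = \<pi> y \<longleftrightarrow> x = y"
  by (meson injD permutes_inj)

lemma grid_line_simps [simp]:
  "grid_line n a b 0 = 0" "grid_line n a b (Suc 0) = a"
  "grid_line n a b (Suc (Suc 0)) = b" "grid_line n a b 2 = b" "grid_line n a b 3 = n + 1"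
  by (simp_all add: grid_line_def)

text \<open>The shaded boxes combine columnwise: the two boxes of each column leave a single range of values
  for the entries of that column.\<close>

lemma mem_occurrences_iff:
  assumes p: "\<pi> permutes {1..n}"
  shows "(s, t) \<in> mesh12_occurrences block_mesh n \<pi> \<longleftrightarrow>
    1 \<le> s \<and> s < t \<and> t \<le> n \<and> \<pi> s < \<pi> t \<and>
    (\<forall>m\<in>{1..n}. (m < s \<longrightarrow> \<pi> t < \<pi> m) \<and> (s < m \<and> m < t \<longrightarrow> \<pi> m < \<pi> s) \<and> (t < m \<longrightarrow> \<pi> t < \<pi> m))"
    (is "?L \<longleftrightarrow> ?R")
proof -
  have rng: "1 \<le> \<pi> m \<and> \<pi> m \<le> n" if "1 \<le> m" "m \<le> n" for m
    using permutes_in_image[OF p, of m] that by simp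
  have "?L \<longleftrightarrow> 1 \<le> s \<and> s < t \<and> t \<le> n \<and> \<pi> s < \<pi> t \<and>
      \<not> (\<exists>m. 0 < m \<and> m < s \<and> 0 < \<pi> m \<and> \<pi> m < \<pi> s) \<and>
      \<not> (\<exists>m. 0 < m \<and> m < s \<and> \<pi> s < \<pi> m \<and> \<pi> m < \<pi> t) \<and>
      \<not> (\<exists>m. s < m \<and> m < t \<and> \<pi> s < \<pi> m \<and> \<pi> m < \<pi> t) \<and>
      \<not> (\<exists>m. s < m \<and> m < t \<and> \<pi> t < \<pi> m \<and> \<pi> m < n + 1) \<and>
      \<not> (\<exists>m. t < m \<and> m < n + 1 \<and> 0 < \<pi> m \<and> \<pi> m < \<pi> s) \<and>
      \<not> (\<exists>m. t < m \<and> m < n + 1 \<and> \<pi> s < \<pi> m \<and> \<pi> m < \<pi> t)"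
    by (simp add: mesh12_occurrences_def block_mesh_def del: not_gr_zero)
  also have "\<dots> \<longleftrightarrow> ?R"
  proof (intro conj_cong refl)
    assume st: "1 \<le> s" "s < t" "t \<le> n" "\<pi> s < \<pi> t"
    let ?c = "\<lambda>m. \<not> (0 < m \<and> m < s \<and> 0 < \<pi> m \<and> \<pi> m < \<pi> s) \<and>
      \<not> (0 < m \<and> m < s \<and> \<pi> s < \<pi> m \<and> \<pi> m < \<pi> t) \<and>
      \<not> (s < m \<and> m < t \<and> \<pi> s < \<pi> m \<and> \<pi> m < \<pi> t) \<and>
      \<not> (s < m \<and> m < t \<and> \<pi> t < \<pi> m \<and> \<pi> m < n + 1) \<and>
      \<not> (t < m \<and> m < n + 1 \<and> 0 < \<pi> m \<and> \<pi> m < \<pi> s) \<and>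
      \<not> (t < m \<and> m < n + 1 \<and> \<pi> s < \<pi> m \<and> \<pi> m < \<pi> t)"
    let ?d = "\<lambda>m. (m < s \<longrightarrow> \<pi> t < \<pi> m) \<and> (s < m \<and> m < t \<longrightarrow> \<pi> m < \<pi> s) \<and> (t < m \<longrightarrow> \<pi> t < \<pi> m)"
    have "?c m \<longleftrightarrow> (m \<in> {1..n} \<longrightarrow> ?d m)" for m
    proof (cases "m \<in> {1..n}")
      case True
      then have r: "1 \<le> \<pi> m" "\<pi> m \<le> n" "1 \<le> m" "m \<le> n" using rng by auto
      have ne: "\<pi> m = \<pi> s \<longleftrightarrow> m = s" "\<pi> m = \<pi> t \<longleftrightarrow> m = t"
        using permutes_eq_iff[OF p] by auto
      consider "m < s" | "m = s" | "s < m" "m < t" | "m = t" | "t < m" by linarith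
      then show ?thesis
        using r ne st True by cases auto
    next
      case False
      then show ?thesis using st by auto
    qed
    then show "(\<not> (\<exists>m. 0 < m \<and> m < s \<and> 0 < \<pi> m \<and> \<pi> m < \<pi> s) \<and>
      \<not> (\<exists>m. 0 < m \<and> m < s \<and> \<pi> s < \<pi> m \<and> \<pi> m < \<pi> t) \<and>
      \<not> (\<exists>m. s < m \<and> m < t \<and> \<pi> s < \<pi> m \<and> \<pi> m < \<pi> t) \<and>
      \<not> (\<exists>m. s < m \<and> m < t \<and> \<pi> t < \<pi> m \<and> \<pi> m < n + 1) \<and>
      \<not> (\<exists>m. t < m \<and> m < n + 1 \<and> 0 < \<pi> m \<and> \<pi> m < \<pi> s) \<and>
      \<not> (\<exists>m. t < m \<and> m < n + 1 \<and> \<pi> s < \<pi> m \<and> \<pi> m < \<pi> t)) \<longleftrightarrow> (\<forall>m\<in>{1..n}. ?d m)"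
      unfolding Ball_def not_ex all_conj_distrib[symmetric] by (rule arg_cong[of _ _ All, OF ext])
  qed
  finally show ?thesis .
qed

text \<open>A value below \<open>\<pi> s\<close> can only sit strictly between \<open>s\<close> and \<open>t\<close>, and every entry there is below
  \<open>\<pi> s\<close>; counting these entries gives \<open>\<pi> s = t - s\<close>.  The value \<open>\<pi> s + 1\<close> has no admissible position
  other than \<open>t\<close>.\<close>

lemma mem_occurrences_iff_block_at:
  assumes p: "\<pi> permutes {1..n}"
  shows "(s, t) \<in> mesh12_occurrences block_mesh n \<pi> \<longleftrightarrow> s < t \<and> block_at n \<pi> s (t - s)"
proof -
  have rng: "1 \<le> \<pi> m \<and> \<pi> m \<le> n" if "1 \<le> m" "m \<le> n" for m
    using permutes_in_image[OF p, of m] that by simp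
  have pre: "\<exists>m. 1 \<le> m \<and> m \<le> n \<and> \<pi> m = v" if "1 \<le> v" "v \<le> n" for v
    using permutes_image[OF p] that by (metis atLeastAtMost_iff imageE)
  have inj: "inj_on \<pi> A" for A
    using p by (meson inj_on_subset permutes_inj subset_UNIV)
  show ?thesis
  proof
    assume "(s, t) \<in> mesh12_occurrences block_mesh n \<pi>"
    then have st: "1 \<le> s" "s < t" "t \<le> n" "\<pi> s < \<pi> t"
      and h: "\<forall>m\<in>{1..n}. (m < s \<longrightarrow> \<pi> t < \<pi> m) \<and> (s < m \<and> m < t \<longrightarrow> \<pi> m < \<pi> s) \<and> (t < m \<longrightarrow> \<pi> t < \<pi> m)"
      unfolding mem_occurrences_iff[OF p] by auto
    have img: "\<pi> ` {s<..<t} = {1..\<pi> s - 1}"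
    proof
      show "\<pi> ` {s<..<t} \<subseteq> {1..\<pi> s - 1}"
      proof
        fix y assume "y \<in> \<pi> ` {s<..<t}"
        then obtain m where m: "s < m" "m < t" "y = \<pi> m" by auto
        then have "\<pi> m < \<pi> s" using h st by auto
        then show "y \<in> {1..\<pi> s - 1}" using m st rng[of m] by auto
      qed
      show "{1..\<pi> s - 1} \<subseteq> \<pi> ` {s<..<t}"
      proof
        fix v assume v: "v \<in> {1..\<pi> s - 1}"
        then have "1 \<le> v" "v \<le> n" using rng[of s] st by auto
        then obtain m where m: "1 \<le> m" "m \<le> n" "\<pi> m = v"
          using pre by blast
        have "v < \<pi> s" using v by auto
        then have "\<not> m < s" "\<not> t < m" "m \<noteq> s" "m \<noteq> t" using h m st by fastforce+
        then show "v \<in> \<pi> ` {s<..<t}" using m by auto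
      qed
    qed
    have "t - Suc s = \<pi> s - 1"
      using arg_cong[OF img, of card] card_image[OF inj] by simp
    moreover have "1 \<le> \<pi> s" using rng[of s] st by simp
    ultimately have a: "\<pi> s = t - s" using st by linarith
    have "\<pi> t = \<pi> s + 1"
    proof -
      have "\<pi> s + 1 \<le> n" using st rng[of t] by simp
      then obtain m where m: "1 \<le> m" "m \<le> n" "\<pi> m = \<pi> s + 1"
        using pre[of "\<pi> s + 1"] by auto
      have "\<not> m < s" "\<not> t < m" "m \<noteq> s" "\<not> (s < m \<and> m < t)" using h m st by fastforce+
      then have "m = t" by linarith
      then show ?thesis using m by simp
    qed
    then show "s < t \<and> block_at n \<pi> s (t - s)"
      using st a img by (simp add: block_at_def)
  next
    assume "s < t \<and> block_at n \<pi> s (t - s)"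
    then have st: "s < t" "1 \<le> s" "t \<le> n" "\<pi> t = \<pi> s + 1" and img: "\<pi> ` {s<..<t} = {1..\<pi> s - 1}"
      by (auto simp: block_at_def)
    show "(s, t) \<in> mesh12_occurrences block_mesh n \<pi>"
      unfolding mem_occurrences_iff[OF p]
    proof (intro conjI ballI)
      fix m assume m: "m \<in> {1..n}"
      have ins: "\<pi> m \<le> \<pi> s - 1 \<longleftrightarrow> m \<in> {s<..<t}"
        using img m rng[of m] inj_image_mem_iff[OF permutes_inj[OF p], of m "{s<..<t}"] by auto
      have ne: "\<pi> m = \<pi> s \<longleftrightarrow> m = s" "\<pi> m = \<pi> t \<longleftrightarrow> m = t"
        using permutes_eq_iff[OF p] by auto
      have "1 \<le> \<pi> s" using rng[of s] st by simp
      with ins ne st show "m < s \<longrightarrow> \<pi> t < \<pi> m" "s < m \<and> m < t \<longrightarrow> \<pi> m < \<pi> s" "t < m \<longrightarrow> \<pi> t < \<pi> m"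
        by auto
    qed (use st in auto)
  qed
qed

section \<open>Counting occurrences by their heads\<close>

definition block_heads :: "nat \<Rightarrow> (nat \<Rightarrow> nat) \<Rightarrow> nat set" where
  "block_heads n \<pi> = {a. \<exists>s. block_at n \<pi> s a}"

lemma block_at_unique:
  "\<pi> permutes A \<Longrightarrow> block_at n \<pi> s a \<Longrightarrow> block_at n \<pi> s' a \<Longrightarrow> s = s'"
  using permutes_eq_iff[of \<pi> A s s'] by (simp add: block_at_def)

lemma block_heads_subset: "block_heads n \<pi> \<subseteq> {1..<n}"
  by (auto simp: block_heads_def block_at_def)

lemma finite_block_heads [simp]: "finite (block_heads n \<pi>)"
  using block_heads_subset finite_subset by blast

lemma mesh12_count_eq_card_block_heads:
  assumes p: "\<pi> permutes {1..n}"
  shows "mesh12_count block_mesh n \<pi> = card (block_heads n \<pi>)"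
  unfolding mesh12_count_def
proof (rule bij_betw_same_card[of "\<lambda>(s, t). t - s"])
  show "bij_betw (\<lambda>(s, t). t - s) (mesh12_occurrences block_mesh n \<pi>) (block_heads n \<pi>)"
  proof (rule bij_betwI')
    fix x y assume xy: "x \<in> mesh12_occurrences block_mesh n \<pi>" "y \<in> mesh12_occurrences block_mesh n \<pi>"
    obtain s t s' t' where "x = (s, t)" "y = (s', t')" by fastforce
    with xy show "((case x of (s, t) \<Rightarrow> t - s) = (case y of (s, t) \<Rightarrow> t - s)) = (x = y)"
      using block_at_unique[OF p, of n s "t - s" s'] by (auto simp: mem_occurrences_iff_block_at[OF p])
  next
    fix x assume "x \<in> mesh12_occurrences block_mesh n \<pi>"
    then show "(case x of (s, t) \<Rightarrow> t - s) \<in> block_heads n \<pi>"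
      by (cases x) (auto simp: mem_occurrences_iff_block_at[OF p] block_heads_def)
  next
    fix a assume "a \<in> block_heads n \<pi>"
    then obtain s where s: "block_at n \<pi> s a" by (auto simp: block_heads_def)
    then have "(s, s + a) \<in> mesh12_occurrences block_mesh n \<pi>"
      by (auto simp: mem_occurrences_iff_block_at[OF p] block_at_def)
    then show "\<exists>x\<in>mesh12_occurrences block_mesh n \<pi>. a = (case x of (s, t) \<Rightarrow> t - s)"
      by force
  qed
qed

text \<open>Listing \<open>A\<close> in increasing order, the exponents on the right are \<open>0, 1, \<dots>, card A - 1\<close>, so this is
  the geometric sum in a form that does not mention the listing.\<close>

lemma power_card_eq_sum_rank:
  fixes q :: "'a::comm_ring_1" and A :: "'b::linorder set"
  assumes "finite A"
  shows "q ^ card A = 1 + (q - 1) * (\<Sum>x\<in>A. q ^ card {y\<in>A. y < x})"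
  using assms
proof (induction A rule: finite_linorder_max_induct)
  case empty
  then show ?case by simp
next
  case (insert b A)
  have nb: "b \<notin> A" using insert.hyps by auto
  have 1: "{y \<in> insert b A. y < b} = A" using insert.hyps by auto
  have "{y \<in> insert b A. y < x} = {y \<in> A. y < x}" if "x \<in> A" for x
    using insert.hyps that by auto
  then have 2: "(\<Sum>x\<in>A. q ^ card {y \<in> insert b A. y < x}) = (\<Sum>x\<in>A. q ^ card {y \<in> A. y < x})"
    by (intro sum.cong) auto
  have "(\<Sum>x\<in>insert b A. q ^ card {y \<in> insert b A. y < x})
      = q ^ card A + (\<Sum>x\<in>A. q ^ card {y \<in> A. y < x})"
    using insert.hyps nb by (simp only: sum.insert 1 2 not_False_eq_True)
  moreover have "q ^ card (insert b A) = q * q ^ card A" using insert.hyps nb by simp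
  ultimately show ?case using insert.IH by (simp add: algebra_simps)
qed

text \<open>A head \<open>c < a\<close> sits inside the block of \<open>a\<close>, and so does its partner \<open>c + 1\<close>: if \<open>c + 1\<close> were equal to
  \<open>a\<close>, it would stand at position \<open>s\<close>, to the left of \<open>c\<close>.  Shifting positions by \<open>s\<close> then identifies the
  smaller blocks of \<open>\<pi>\<close> with the blocks of \<open>\<sigma>\<close>.\<close>

lemma block_heads_below:
  assumes p: "\<pi> permutes {1..n}" and b: "block_at n \<pi> s a"
    and \<sigma>: "\<And>i. i \<in> {1..a - 1} \<Longrightarrow> \<pi> (s + i) = \<sigma> i"
  shows "{c \<in> block_heads n \<pi>. c < a} = block_heads (a - 1) \<sigma>"
proof -
  have B: "1 \<le> a" "1 \<le> s" "s + a \<le> n" "\<pi> s = a" "\<pi> (s + a) = a + 1" "\<pi> ` {s<..<s + a} = {1..a - 1}"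
    using b by (auto simp: block_at_def)
  have inside: "\<pi> m \<in> {1..a - 1} \<longleftrightarrow> s < m \<and> m < s + a" for m
    using B(6) inj_image_mem_iff[OF permutes_inj[OF p], of m "{s<..<s + a}"] by auto
  have shift: "\<pi> ` {s + r<..<s + r + c} = \<sigma> ` {r<..<r + c}" if "r + c \<le> a - 1" for r c
  proof -
    have "{s + r<..<s + r + c} = (+) s ` {r<..<r + c}"
      by (simp add: ac_simps flip: atLeastSucLessThan_greaterThanLessThan)
    then have "\<pi> ` {s + r<..<s + r + c} = (\<lambda>i. \<pi> (s + i)) ` {r<..<r + c}"
      by (simp add: image_image)
    also have "\<dots> = \<sigma> ` {r<..<r + c}"
      using \<sigma> that by (intro image_cong) auto
    finally show ?thesis .
  qed
  show ?thesis
  proof (intro equalityI subsetI)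
    fix c assume "c \<in> {c \<in> block_heads n \<pi>. c < a}"
    then obtain r' where ca: "c < a" and "block_at n \<pi> r' c" by (auto simp: block_heads_def)
    then have C: "1 \<le> c" "1 \<le> r'" "r' + c \<le> n" "\<pi> r' = c" "\<pi> (r' + c) = c + 1"
      "\<pi> ` {r'<..<r' + c} = {1..c - 1}"
      by (auto simp: block_at_def)
    have r': "s < r'" "r' < s + a" using inside[of r'] C ca by auto
    have "r' + c \<noteq> s" using r' by simp
    then have "c + 1 \<noteq> a" using C(5) B(4) permutes_eq_iff[OF p, of "r' + c" s] by auto
    then have rc: "r' + c < s + a" using inside[of "r' + c"] C ca by auto
    define r where "r = r' - s"
    have r: "r' = s + r" "1 \<le> r" "r + c \<le> a - 1" using r' rc by (auto simp: r_def)
    have "block_at (a - 1) \<sigma> r c"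
      using C r \<sigma>[of r] \<sigma>[of "r + c"] shift[of r c] by (auto simp: block_at_def add.assoc)
    then show "c \<in> block_heads (a - 1) \<sigma>" by (auto simp: block_heads_def)
  next
    fix c assume "c \<in> block_heads (a - 1) \<sigma>"
    then obtain r where C: "1 \<le> c" "1 \<le> r" "r + c \<le> a - 1" "\<sigma> r = c" "\<sigma> (r + c) = c + 1"
      "\<sigma> ` {r<..<r + c} = {1..c - 1}"
      by (auto simp: block_heads_def block_at_def)
    have "block_at n \<pi> (s + r) c"
      using C B \<sigma>[of r] \<sigma>[of "r + c"] shift[of r c] by (auto simp: block_at_def add.assoc)
    then show "c \<in> {c \<in> block_heads n \<pi>. c < a}" using C by (auto simp: block_heads_def)
  qed
qed

section \<open>Permutations with a given block\<close>

text \<open>The permutation in one-line notation is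
  \<open>a + 2, \<dots>, a + s, a, 1, \<dots>, a - 1, a + 1, a + s + 1, a + s + 2, \<dots>\<close>: it has the block with head \<open>a\<close> at
  position \<open>s\<close>.  Every other permutation with this block arises from it by permuting the
  values below \<open>a\<close> and the values above \<open>a + 1\<close> among themselves.\<close>

definition base_perm :: "nat \<Rightarrow> nat \<Rightarrow> nat \<Rightarrow> nat" where
  "base_perm s a i =
     (if 1 \<le> i \<and> i < s then i + a + 1
      else if i = s then a
      else if s < i \<and> i < s + a then i - s
      else if i = s + a then a + 1
      else i)"

lemma base_perm_permutes:
  assumes "1 \<le> a" "1 \<le> s" "s + a \<le> n"
  shows "base_perm s a permutes {1..n}"
proof (rule bij_imp_permutes)
  have inj: "inj_on (base_perm s a) {1..n}"
    using assms by (auto simp: inj_on_def base_perm_def split: if_splits)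
  have "base_perm s a ` {1..n} \<subseteq> {1..n}"
    using assms by (auto simp: base_perm_def)
  then show "bij_betw (base_perm s a) {1..n} {1..n}"
    using inj by (simp add: bij_betw_def endo_inj_surj)
  show "base_perm s a x = x" if "x \<notin> {1..n}" for x
    using that assms by (auto simp: base_perm_def)
qed

lemma permutes_restrict:
  assumes "bij_betw f A A"
  shows "(\<lambda>x. if x \<in> A then f x else x) permutes A"
  using assms by (intro bij_imp_permutes) (auto cong: bij_betw_cong)

lemma block_at_compose:
  assumes sa: "1 \<le> a" "1 \<le> s" "s + a \<le> n"
    and \<sigma>: "\<sigma> permutes {1..a - 1}" and \<tau>: "\<tau> permutes {a + 2..n}"
  shows "\<sigma> \<circ> \<tau> \<circ> base_perm s a \<in> {\<pi> \<in> perms n. block_at n \<pi> s a}"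
    and "i \<in> {1..a - 1} \<Longrightarrow> (\<sigma> \<circ> \<tau> \<circ> base_perm s a) (s + i) = \<sigma> i"
proof -
  have val: "(\<sigma> \<circ> \<tau> \<circ> base_perm s a) (s + i) = \<sigma> i" if "i \<in> {1..a - 1}" for i
    using that permutes_not_in[OF \<tau>, of i] by (auto simp: base_perm_def)
  then show "i \<in> {1..a - 1} \<Longrightarrow> (\<sigma> \<circ> \<tau> \<circ> base_perm s a) (s + i) = \<sigma> i" .
  have perm: "\<sigma> \<circ> \<tau> \<circ> base_perm s a permutes {1..n}"
    using sa by (intro permutes_compose base_perm_permutes permutes_subset[OF \<sigma>]
        permutes_subset[OF \<tau>]) auto
  have "{s<..<s + a} = (+) s ` {1..a - 1}"
    by (auto simp: image_iff intro!: bexI[of _ "_ - s"])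
  then have "(\<sigma> \<circ> \<tau> \<circ> base_perm s a) ` {s<..<s + a} = (\<lambda>i. (\<sigma> \<circ> \<tau> \<circ> base_perm s a) (s + i)) ` {1..a - 1}"
    by (simp only: image_image)
  also have "\<dots> = \<sigma> ` {1..a - 1}"
    using val by (intro image_cong) auto
  also have "\<dots> = {1..a - 1}" by (rule permutes_image[OF \<sigma>])
  finally have img: "(\<sigma> \<circ> \<tau> \<circ> base_perm s a) ` {s<..<s + a} = {1..a - 1}" .
  have "(\<sigma> \<circ> \<tau> \<circ> base_perm s a) s = a" "(\<sigma> \<circ> \<tau> \<circ> base_perm s a) (s + a) = a + 1"
    using sa permutes_not_in[OF \<tau>, of a] permutes_not_in[OF \<tau>, of "a + 1"]
      permutes_not_in[OF \<sigma>, of a] permutes_not_in[OF \<sigma>, of "a + 1"]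
    by (auto simp: base_perm_def)
  with img perm sa show "\<sigma> \<circ> \<tau> \<circ> base_perm s a \<in> {\<pi> \<in> perms n. block_at n \<pi> s a}"
    by (simp add: perms_def block_at_def)
qed

text \<open>For surjectivity, \<open>\<rho> = \<pi> \<circ> inv (base_perm s a)\<close> fixes \<open>a\<close> and \<open>a + 1\<close> and preserves \<open>{1..a - 1}\<close>, hence
  also preserves the remaining values \<open>{a + 2..n}\<close>; the two factors are its restrictions.\<close>

lemma bij_betw_block_decomposition:
  assumes sa: "1 \<le> a" "1 \<le> s" "s + a \<le> n"
  shows "bij_betw (\<lambda>(\<sigma>, \<tau>). \<sigma> \<circ> \<tau> \<circ> base_perm s a)
    (perms (a - 1) \<times> {\<tau>. \<tau> permutes {a + 2..n}}) {\<pi> \<in> perms n. block_at n \<pi> s a}"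
proof (rule bij_betw_imageI)
  note base = base_perm_permutes[OF sa]
  show "inj_on (\<lambda>(\<sigma>, \<tau>). \<sigma> \<circ> \<tau> \<circ> base_perm s a) (perms (a - 1) \<times> {\<tau>. \<tau> permutes {a + 2..n}})"
  proof (rule inj_onI, clarsimp simp: perms_def)
    fix \<sigma> \<tau> \<sigma>' \<tau>'
    assume \<sigma>: "\<sigma> permutes {Suc 0..a - Suc 0}" "\<sigma>' permutes {Suc 0..a - Suc 0}"
      and \<tau>: "\<tau> permutes {Suc (Suc a)..n}" "\<tau>' permutes {Suc (Suc a)..n}"
      and eq: "\<sigma> \<circ> \<tau> \<circ> base_perm s a = \<sigma>' \<circ> \<tau>' \<circ> base_perm s a"
    have "\<sigma> x = \<sigma>' x" for x
    proof (cases "x \<in> {1..a - 1}")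
      case True
      then show ?thesis
        using block_at_compose(2)[OF sa, of \<sigma> \<tau> x] block_at_compose(2)[OF sa, of \<sigma>' \<tau>' x] \<sigma> \<tau> eq
        by simp
    next
      case False
      then show ?thesis using permutes_not_in[of \<sigma> _ x] permutes_not_in[of \<sigma>' _ x] \<sigma> by simp
    qed
    then have s: "\<sigma> = \<sigma>'" by auto
    have "\<tau> x = \<tau>' x" for x
    proof -
      obtain y where "x = base_perm s a y" using permutes_surj[OF base] by (metis surjD)
      then have "\<sigma> (\<tau> x) = \<sigma> (\<tau>' x)" using fun_cong[OF eq, of y] s by simp
      then show ?thesis using permutes_eq_iff[OF \<sigma>(1)] by simp
    qed
    then show "\<sigma> = \<sigma>' \<and> \<tau> = \<tau>'" using s by auto
  qed
  show "(\<lambda>(\<sigma>, \<tau>). \<sigma> \<circ> \<tau> \<circ> base_perm s a) ` (perms (a - 1) \<times> {\<tau>. \<tau> permutes {a + 2..n}})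
    = {\<pi> \<in> perms n. block_at n \<pi> s a}"
  proof (intro equalityI subsetI)
    fix \<pi> assume "\<pi> \<in> (\<lambda>(\<sigma>, \<tau>). \<sigma> \<circ> \<tau> \<circ> base_perm s a) ` (perms (a - 1) \<times> {\<tau>. \<tau> permutes {a + 2..n}})"
    then show "\<pi> \<in> {\<pi> \<in> perms n. block_at n \<pi> s a}"
      using block_at_compose(1)[OF sa] by (auto simp only: perms_def mem_Collect_eq)
  next
    fix \<pi> assume "\<pi> \<in> {\<pi> \<in> perms n. block_at n \<pi> s a}"
    then have p: "\<pi> permutes {1..n}" and B: "\<pi> s = a" "\<pi> (s + a) = a + 1" "\<pi> ` {s<..<s + a} = {1..a - 1}"
      by (auto simp: perms_def block_at_def)
    define \<rho> where "\<rho> = \<pi> \<circ> inv (base_perm s a)"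
    have \<rho>: "\<rho> permutes {1..n}"
      unfolding \<rho>_def by (intro permutes_compose permutes_inv base p)
    have comp: "\<rho> (base_perm s a i) = \<pi> i" for i
      unfolding \<rho>_def using permutes_inverses(2)[OF base] by simp
    have fix_a: "\<rho> a = a" "\<rho> (a + 1) = a + 1"
      using comp[of s] comp[of "s + a"] B sa by (auto simp: base_perm_def)
    have "{1..a - 1} = base_perm s a ` {s<..<s + a}"
      by (auto simp: base_perm_def image_iff intro!: bexI[of _ "s + _"])
    then have low: "\<rho> ` {1..a - 1} = {1..a - 1}"
      using B(3) comp by (simp add: image_image)
    have "{a + 2..n} = {1..n} - {1..a - 1} - {a, a + 1}" using sa by auto
    then have high: "\<rho> ` {a + 2..n} = {a + 2..n}"
      using permutes_image[OF \<rho>] low fix_a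
      by (simp add: image_set_diff[OF permutes_inj[OF \<rho>]])
    have bij: "bij_betw \<rho> A A" if "\<rho> ` A = A" for A
      using that permutes_inj[OF \<rho>] by (auto simp: bij_betw_def intro: inj_on_subset)
    define \<sigma> where "\<sigma> = (\<lambda>x. if x \<in> {1..a - 1} then \<rho> x else x)"
    define \<tau> where "\<tau> = (\<lambda>x. if x \<in> {a + 2..n} then \<rho> x else x)"
    have st: "\<sigma> permutes {1..a - 1}" "\<tau> permutes {a + 2..n}"
      unfolding \<sigma>_def \<tau>_def using low high by (intro permutes_restrict bij; simp)+
    have "\<sigma> (\<tau> x) = \<rho> x" for x
    proof -
      consider "x \<in> {1..a - 1}" | "x \<in> {a + 2..n}" | "x = a" | "x = a + 1" | "x \<notin> {1..n}"
        using sa by force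
      then show ?thesis
      proof cases
        case 1
        then show ?thesis by (auto simp: \<sigma>_def \<tau>_def)
      next
        case 2
        then have "\<rho> x \<in> {a + 2..n}" using high by blast
        then show ?thesis using 2 by (auto simp: \<sigma>_def \<tau>_def)
      next
        case 5
        then show ?thesis using permutes_not_in[OF \<rho>, of x] sa by (auto simp: \<sigma>_def \<tau>_def)
      qed (use fix_a sa in \<open>auto simp: \<sigma>_def \<tau>_def\<close>)
    qed
    then have "\<pi> = \<sigma> \<circ> \<tau> \<circ> base_perm s a" using comp by (auto simp: fun_eq_iff)
    then show "\<pi> \<in> (\<lambda>(\<sigma>, \<tau>). \<sigma> \<circ> \<tau> \<circ> base_perm s a) ` (perms (a - 1) \<times> {\<tau>. \<tau> permutes {a + 2..n}})"
      using st by (auto simp: perms_def)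
  qed
qed

section \<open>The recurrence and the generating functions\<close>

definition block_enum :: "nat \<Rightarrow> 'a::comm_ring_1 \<Rightarrow> 'a" where
  "block_enum n q = (\<Sum>\<pi>\<in>perms n. q ^ card (block_heads n \<pi>))"

lemma finite_perms [simp]: "finite (perms n)"
  by (simp add: perms_def finite_permutations)

lemma sum_block_at:
  fixes q :: "'a::comm_ring_1"
  assumes sa: "1 \<le> a" "1 \<le> s" "s + a \<le> n"
  shows "(\<Sum>\<pi> | \<pi> \<in> perms n \<and> block_at n \<pi> s a. q ^ card {c \<in> block_heads n \<pi>. c < a})
    = of_nat (fact (n - a - 1)) * block_enum (a - 1) q"
proof -
  let ?T = "{\<tau>. \<tau> permutes {a + 2..n}}"
  have w: "{c \<in> block_heads n (\<sigma> \<circ> \<tau> \<circ> base_perm s a). c < a} = block_heads (a - 1) \<sigma>"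
    if "\<sigma> \<in> perms (a - 1)" "\<tau> \<in> ?T" for \<sigma> \<tau>
  proof (rule block_heads_below)
    have \<sigma>: "\<sigma> permutes {1..a - 1}" and \<tau>: "\<tau> permutes {a + 2..n}"
      using that by (auto simp: perms_def)
    show "\<sigma> \<circ> \<tau> \<circ> base_perm s a permutes {1..n}" "block_at n (\<sigma> \<circ> \<tau> \<circ> base_perm s a) s a"
      using block_at_compose(1)[OF sa \<sigma> \<tau>] by (auto simp: perms_def)
    show "(\<sigma> \<circ> \<tau> \<circ> base_perm s a) (s + i) = \<sigma> i" if "i \<in> {1..a - 1}" for i
      using block_at_compose(2)[OF sa \<sigma> \<tau>] that .
  qed
  have "(\<Sum>\<pi> | \<pi> \<in> perms n \<and> block_at n \<pi> s a. q ^ card {c \<in> block_heads n \<pi>. c < a})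
    = (\<Sum>x\<in>perms (a - 1) \<times> ?T.
        q ^ card {c \<in> block_heads n ((\<lambda>(\<sigma>, \<tau>). \<sigma> \<circ> \<tau> \<circ> base_perm s a) x). c < a})"
    by (rule sum.reindex_bij_betw[symmetric, OF bij_betw_block_decomposition[OF sa]])
  also have "\<dots> = (\<Sum>(\<sigma>, \<tau>)\<in>perms (a - 1) \<times> ?T. q ^ card (block_heads (a - 1) \<sigma>))"
    using w by (intro sum.cong) auto
  also have "\<dots> = (\<Sum>\<sigma>\<in>perms (a - 1). \<Sum>\<tau>\<in>?T. q ^ card (block_heads (a - 1) \<sigma>))"
    by (rule sum.cartesian_product[symmetric])
  also have "\<dots> = of_nat (card ?T) * block_enum (a - 1) q"
    by (simp add: block_enum_def sum_distrib_left)
  also have "card ?T = fact (n - a - 1)"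
    by (rule card_permutations) auto
  finally show ?thesis .
qed

text \<open>The factor \<open>(n - a)!\<close> collects the \<open>n - a\<close> possible positions \<open>s\<close> of the block and the
  \<open>(n - a - 1)!\<close> arrangements of the values above \<open>a + 1\<close>.\<close>

lemma block_enum_rec:
  fixes q :: "'a::{comm_ring_1, semiring_char_0}"
  shows "block_enum n q = fact n + (q - 1) * (\<Sum>a = 1..<n. fact (n - a) * block_enum (a - 1) q)"
proof -
  let ?w = "\<lambda>\<pi> a. q ^ card {c \<in> block_heads n \<pi>. c < a}"
  \<comment> \<open>The position of a block is unique for given \<open>\<pi>\<close> and \<open>a\<close>, so it can be summed over as well; this
    turns the range of summation into one that does not depend on \<open>\<pi>\<close>.\<close>
  have heads: "(\<Sum>a\<in>block_heads n \<pi>. ?w \<pi> a)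
      = (\<Sum>a = 1..<n. \<Sum>s = 1..n - a. if block_at n \<pi> s a then ?w \<pi> a else 0)" if "\<pi> \<in> perms n" for \<pi>
  proof -
    have p: "\<pi> permutes {1..n}" using that by (simp add: perms_def)
    have "(\<Sum>s = 1..n - a. if block_at n \<pi> s a then ?w \<pi> a else 0)
        = (if a \<in> block_heads n \<pi> then ?w \<pi> a else 0)" for a
    proof (cases "a \<in> block_heads n \<pi>")
      case True
      then obtain r where r: "block_at n \<pi> r a" by (auto simp: block_heads_def)
      then have "block_at n \<pi> s a \<longleftrightarrow> s = r" for s using block_at_unique[OF p] by blast
      moreover have "r \<in> {1..n - a}" using r by (auto simp: block_at_def)
      ultimately show ?thesis using True by simp
    next
      case False
      then show ?thesis by (simp add: block_heads_def)
    qed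
    then show ?thesis
      using block_heads_subset[of n \<pi>] by (simp add: sum.If_cases Int_absorb1)
  qed
  have "block_enum n q = (\<Sum>\<pi>\<in>perms n. 1 + (q - 1) * (\<Sum>a\<in>block_heads n \<pi>. ?w \<pi> a))"
    unfolding block_enum_def using power_card_eq_sum_rank[OF finite_block_heads, of q] by simp
  also have "\<dots> = of_nat (card (perms n)) + (q - 1) * (\<Sum>\<pi>\<in>perms n. \<Sum>a\<in>block_heads n \<pi>. ?w \<pi> a)"
    by (simp add: sum.distrib sum_distrib_left)
  also have "card (perms n) = fact n"
    unfolding perms_def by (rule card_permutations) auto
  also have "(\<Sum>\<pi>\<in>perms n. \<Sum>a\<in>block_heads n \<pi>. ?w \<pi> a)
      = (\<Sum>\<pi>\<in>perms n. \<Sum>a = 1..<n. \<Sum>s = 1..n - a. if block_at n \<pi> s a then ?w \<pi> a else 0)"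
    using heads by (rule sum.cong[OF refl])
  also have "\<dots> = (\<Sum>a = 1..<n. \<Sum>\<pi>\<in>perms n. \<Sum>s = 1..n - a. if block_at n \<pi> s a then ?w \<pi> a else 0)"
    by (rule sum.swap)
  also have "\<dots> = (\<Sum>a = 1..<n. \<Sum>s = 1..n - a. \<Sum>\<pi>\<in>perms n. if block_at n \<pi> s a then ?w \<pi> a else 0)"
    by (intro sum.cong refl sum.swap)
  also have "\<dots> = (\<Sum>a = 1..<n. \<Sum>s = 1..n - a. of_nat (fact (n - a - 1)) * block_enum (a - 1) q)"
  proof (intro sum.cong refl)
    fix a s assume "a \<in> {1..<n}" "s \<in> {1..n - a}"
    then have "1 \<le> a" "1 \<le> s" "s + a \<le> n" by auto
    note sum_block_at[OF this, of q]
    then show "(\<Sum>\<pi>\<in>perms n. if block_at n \<pi> s a then ?w \<pi> a else 0)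
        = of_nat (fact (n - a - 1)) * block_enum (a - 1) q"
      by (simp add: sum.inter_filter)
  qed
  also have "\<dots> = (\<Sum>a = 1..<n. fact (n - a) * block_enum (a - 1) q)"
  proof (intro sum.cong refl)
    fix a assume "a \<in> {1..<n}"
    then obtain k where "n - a = Suc k" by (cases "n - a") auto
    then show "(\<Sum>s = 1..n - a. of_nat (fact (n - a - 1)) * block_enum (a - 1) q) = fact (n - a) * block_enum (a - 1) q"
      by (simp add: algebra_simps)
  qed
  finally show ?thesis by simp
qed

lemma distr_gf_nth: "distr_gf block_mesh q $ n = block_enum n q"
  by (auto simp: distr_gf_def block_enum_def perms_def mesh12_count_eq_card_block_heads intro!: sum.cong)

lemma distr_gf_eq:
  fixes q :: "'a::{comm_ring_1, semiring_char_0}"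
  shows "(1 + fps_const (1 - q) * fps_X * (fact_gf - 1)) * distr_gf block_mesh q = fact_gf"
proof (rule fps_ext)
  fix n
  let ?D = "distr_gf block_mesh q"
  have conv: "(fps_X * ((fact_gf - 1) * ?D)) $ n = (\<Sum>a = 1..<n. fact (n - a) * block_enum (a - 1) q)"
  proof (cases n)
    case (Suc m)
    have "(fps_X * ((fact_gf - 1) * ?D)) $ n = ((fact_gf - 1) * ?D) $ m"
      using Suc by simp
    also have "\<dots> = (\<Sum>i = 0..m. block_enum i q * (fact_gf - 1) $ (m - i))"
      by (subst mult.commute) (simp add: fps_mult_nth distr_gf_nth)
    \<comment> \<open>The constant term of \<open>F - 1\<close> vanishes, which removes \<open>i = m\<close>; then \<open>i = a - 1\<close>.\<close>
    also have "\<dots> = (\<Sum>i = 0..<m. block_enum i q * (fact_gf - 1) $ (m - i))"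
      by (simp add: atLeast0AtMost lessThan_Suc_atMost[symmetric] lessThan_atLeast0 fact_gf_def)
    also have "\<dots> = (\<Sum>i = 0..<m. fact (m - i) * block_enum i q)"
      by (intro sum.cong refl) (auto simp: fact_gf_def mult.commute)
    also have "\<dots> = (\<Sum>a = 1..<n. fact (n - a) * block_enum (a - 1) q)"
      using sum.shift_bounds_Suc_ivl[of "\<lambda>a. fact (n - a) * block_enum (a - 1) q" 0 m] Suc by simp
    finally show ?thesis .
  qed simp
  have "(1 + fps_const (1 - q) * fps_X * (fact_gf - 1)) * ?D
      = ?D + fps_const (1 - q) * (fps_X * ((fact_gf - 1) * ?D))"
    by (simp add: algebra_simps)
  then have "((1 + fps_const (1 - q) * fps_X * (fact_gf - 1)) * ?D) $ n
      = block_enum n q + (1 - q) * (\<Sum>a = 1..<n. fact (n - a) * block_enum (a - 1) q)"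
    by (simp add: conv distr_gf_nth del: fps_X_mult_nth)
  also have "\<dots> = fact n"
    by (subst block_enum_rec) (simp add: algebra_simps)
  finally show "((1 + fps_const (1 - q) * fps_X * (fact_gf - 1)) * ?D) $ n = fact_gf $ n"
    by (simp add: fact_gf_def)
qed

lemma distr_gf_eq_quotient:
  fixes q :: "'a::field_char_0"
  shows "distr_gf block_mesh q = fact_gf / (1 + fps_const (1 - q) * fps_X * (fact_gf - 1))"
proof -
  let ?G = "1 + fps_const (1 - q) * fps_X * (fact_gf - 1) :: 'a fps"
  have "?G $ 0 = 1" by (simp add: mult.assoc)
  then have "?G \<noteq> 0" by force
  then have "?G * distr_gf block_mesh q / ?G = distr_gf block_mesh q" by (rule nonzero_mult_div_cancel_left)
  then show ?thesis by (simp only: distr_gf_eq)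
qed

text \<open>Here \<open>0 ^ 0 = 1\<close> is what counts the avoiders.\<close>

lemma avoid_gf_eq_distr_gf: "(avoid_gf R :: 'a::comm_ring_1 fps) = distr_gf R 0"
proof (rule fps_ext)
  fix n
  have "(\<Sum>\<pi>\<in>perms n. 0 ^ mesh12_count R n \<pi> :: 'a) = of_nat (card (mesh12_avoiders R n))"
    by (simp add: power_0_left sum.If_cases mesh12_avoiders_def Collect_conj_eq)
  then show "avoid_gf R $ n = (distr_gf R 0 :: 'a fps) $ n"
    by (simp add: avoid_gf_def distr_gf_def)
qed

theorem theorem3p8:
  fixes R :: "(nat \<times> nat) set"
  assumes "R = {(0,0), (0,1), (1,1), (1,2), (2,0), (2,1)}"
  shows "(avoid_gf R :: rat fps) = fact_gf / (1 + fps_X * (fact_gf - 1)) \<and>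
         distr_gf R q_var = fact_gf / (1 + fps_const (1 - q_var) * fps_X * (fact_gf - 1))"
  unfolding assms block_mesh_def[symmetric] avoid_gf_eq_distr_gf
  using distr_gf_eq_quotient[of "0 :: rat"] distr_gf_eq_quotient[of q_var] by simp

end
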